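(* Let $G$ be a finite simple connected graph with at least two vertices, and let $\lambda_2(G)$ be its second largest distance eigenvalue. If $\lambda_2(G)<-\frac{1}{2}$, then $G$ is chordal.
   Context: For a finite simple connected graph $G$ with vertex set $\{v_1,\dots,v_n\}$, $n\ge 2$, $d_G(u,v)$ is the length of a shortest path between $u$ and $v$, and the distance matrix is the real symmetric matrix $D(G)=(d_G(v_i,v_j))_{1\le i,j\le n}$. Its eigenvalues, listed with multiplicity as $\lambda_1(G)\ge\lambda_2(G)\ge\dots\ge\lambda_n(G)$, are the distance eigenvalues of $G$; $\lambda_2(G)$ is the second largest distance eigenvalue. A graph is chordal if every cycle of length at least four in it has a chord, i.e. an edge of the graph joining two vertices that are not adjacent on the cycle (equivalently, there is no induced cycle of length at least four). *)

theory Defs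
  imports
    "Graph_Theory.Graph_Theory"
    "Jordan_Normal_Form.Char_Poly"
begin

text \<open>
  A finite simple graph is a \<open>pair_graph\<close>: a finite loop-free digraph without parallel arcs whose
  arc relation is symmetric, so an undirected edge is the pair of arcs \<open>(u, v)\<close>, \<open>(v, u)\<close>.
\<close>

definition graph_dist :: "'a pair_pre_digraph \<Rightarrow> 'a \<Rightarrow> 'a \<Rightarrow> nat" where
  "graph_dist G u v = (LEAST k. \<exists>p. pre_digraph.apath (with_proj G) u p v \<and> length p = k)"

text \<open>The list \<open>vs\<close> enumerates the vertices of \<open>G\<close> as $v_1,\dots,v_n$ (with indices from 0).\<close>

definition distance_matrix :: "'a pair_pre_digraph \<Rightarrow> 'a list \<Rightarrow> real mat" where
  "distance_matrix G vs =
     mat (length vs) (length vs) (\<lambda>(i, j). real (graph_dist G (vs ! i) (vs ! j)))"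

text \<open>
  The eigenvalues in non-increasing order, repeated according to their multiplicity as roots of the
  characteristic polynomial. Only real roots are listed; these are all of them when \<open>A\<close> is symmetric,
  and the list then has length \<open>dim_row A\<close>.
\<close>

definition eigenvalues_desc :: "real mat \<Rightarrow> real list" where
  "eigenvalues_desc A = rev (sorted_list_of_multiset (proots (char_poly A)))"

text \<open>List indices start at 0, so entry 1 is $\lambda_2$.\<close>

definition second_distance_eigenvalue :: "'a pair_pre_digraph \<Rightarrow> 'a list \<Rightarrow> real" where
  "second_distance_eigenvalue G vs = eigenvalues_desc (distance_matrix G vs) ! 1"

text \<open>
  A cycle is given by its list of arcs \<open>p\<close>, so \<open>length p\<close> is its length, and two vertices are adjacent
  on the cycle iff they are joined by an arc of \<open>p\<close> in one of the two directions.
  The library's \<open>cycle\<close> admits the closed walk along a single edge and back, which is not a cycle of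
  an undirected graph; it has length 2 and is excluded below by the bound on the length.
\<close>

definition is_chord :: "'a pair_pre_digraph \<Rightarrow> ('a \<times> 'a) awalk \<Rightarrow> 'a \<Rightarrow> 'a \<Rightarrow> bool" where
  "is_chord G p x y \<longleftrightarrow>
     x \<in> fst ` set p \<and> y \<in> fst ` set p \<and>
     (x, y) \<in> parcs G \<and> (x, y) \<notin> set p \<and> (y, x) \<notin> set p"

definition chordal :: "'a pair_pre_digraph \<Rightarrow> bool" where
  "chordal G \<longleftrightarrow>
     (\<forall>p. pre_digraph.cycle (with_proj G) p \<and> length p \<ge> 4 \<longrightarrow> (\<exists>x y. is_chord G p x y))"

end

theory Submission
  imports Defs
begin

text \<open>
  On a chordless cycle of length at least four, a shortest stretch that is not a geodesic, together
  with the geodesy of its proper sub-stretches, yields four vertices \<open>a, b, c, d\<close> such that \<open>ab\<close> and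
  \<open>cd\<close> are edges, \<open>d(a,c) = d(b,d) = m\<close> and \<open>d(b,c) + d(a,d) < 2 m\<close>. On the plane spanned by
  \<open>e\<^sub>a + e\<^sub>c\<close> and \<open>e\<^sub>b + e\<^sub>d\<close> the Rayleigh quotient of the distance matrix is then at least
  \<open>- 1 / 2\<close>, so the second largest eigenvalue is at least \<open>- 1 / 2\<close> by the min-max principle.
\<close>

section \<open>Spectrum of real symmetric matrices\<close>

lemma mult_mat_vec_symmetric_swap:
  fixes A :: "'a :: comm_semiring_0 mat"
  assumes "A \<in> carrier_mat n n" "transpose_mat A = A"
    and "x \<in> carrier_vec n" "y \<in> carrier_vec n"
  shows "(A *\<^sub>v y) \<bullet> x = y \<bullet> (A *\<^sub>v x)"
  using transpose_vec_mult_scalar[OF assms(1,3,4)] assms(2) by simp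

text \<open>Moving the symmetric matrix across its product with \<open>v\<close> and
  \<open>conjugate v\<close> yields \<open>a\<close> and \<open>cnj a\<close> times the same nonzero
  number, the squared length of \<open>v\<close>.\<close>

lemma symmetric_real_mat_complex_eigenvalue_real:
  fixes A :: "real mat"
  assumes A: "A \<in> carrier_mat n n" and sym: "transpose_mat A = A"
    and ev: "eigenvalue (map_mat complex_of_real A) a"
  shows "a \<in> \<real>"
proof -
  let ?C = "map_mat complex_of_real A"
  have C: "?C \<in> carrier_mat n n" using A by auto
  have symC: "transpose_mat ?C = ?C"
    by (metis sym map_mat_transpose)
  obtain v where v: "v \<in> carrier_vec n" "v \<noteq> 0\<^sub>v n" and eig: "?C *\<^sub>v v = a \<cdot>\<^sub>v v"
    using ev A unfolding eigenvalue_def eigenvector_def by auto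
  have cv: "conjugate v \<in> carrier_vec n" using v(1) by simp
  \<comment> \<open>Conjugation commutes with the matrix because its entries are real, so
    \<open>conjugate v\<close> is an eigenvector for \<open>cnj a\<close>.\<close>
  have "conjugate (?C *\<^sub>v v) = ?C *\<^sub>v conjugate v"
    by (rule eq_vecI) (use A v(1) in \<open>auto simp: scalar_prod_def cnj_sum\<close>)
  hence eig': "?C *\<^sub>v conjugate v = cnj a \<cdot>\<^sub>v conjugate v"
    using eig v(1) by (simp add: conjugate_smult_vec)
  have "cnj a * (conjugate v \<bullet> v) = (?C *\<^sub>v conjugate v) \<bullet> v"
    using eig' v(1) cv by simp
  also have "\<dots> = conjugate v \<bullet> (?C *\<^sub>v v)"
    by (rule mult_mat_vec_symmetric_swap[OF C symC v(1) cv])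
  also have "\<dots> = a * (conjugate v \<bullet> v)"
    using eig v(1) cv by simp
  finally have "cnj a * (conjugate v \<bullet> v) = a * (conjugate v \<bullet> v)" .
  moreover have "conjugate v \<bullet> v \<noteq> 0"
    using v conjugate_square_eq_0_vec[of v n] comm_scalar_prod[OF cv v(1)] by auto
  ultimately have "cnj a = a" by simp
  thus ?thesis by (simp add: Reals_cnj_iff)
qed

text \<open>Over the complex numbers the characteristic polynomial splits. Its roots are
  eigenvalues, hence real, and injectivity of the embedding of real polynomials pulls the
  factorization back.\<close>

lemma symmetric_real_char_poly_splits:
  fixes A :: "real mat"
  assumes A: "A \<in> carrier_mat n n" and sym: "transpose_mat A = A"
  shows "\<exists>es. char_poly A = (\<Prod>e\<leftarrow>es. [:- e, 1:])"
proof -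
  let ?C = "map_mat complex_of_real A"
  interpret h: map_poly_inj_idom_hom "of_real :: real \<Rightarrow> complex" ..
  have C: "?C \<in> carrier_mat n n" using A by auto
  obtain as where as: "char_poly ?C = (\<Prod>a\<leftarrow>as. [:- a, 1:])"
    using char_poly_factorized[OF C] by auto
  have "a \<in> \<real>" if "a \<in> set as" for a
  proof -
    have "poly (char_poly ?C) a = 0"
      unfolding as using linear_poly_root[OF that] by simp
    thus ?thesis
      using symmetric_real_mat_complex_eigenvalue_real[OF A sym] eigenvalue_root_char_poly[OF C]
      by auto
  qed
  hence "map of_real (map Re as) = as"
    by (intro nth_equalityI) (auto simp: complex_is_Real_iff complex_eq_iff)
  then obtain es where es: "as = map of_real es" by metis
  have "map_poly complex_of_real (char_poly A) = char_poly ?C"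
    by (rule of_real_hom.char_poly_hom[OF A, symmetric])
  also have "\<dots> = map_poly of_real (\<Prod>e\<leftarrow>es. [:- e, 1:])"
    unfolding as es by (simp add: h.hom_prod_list o_def)
  finally have "char_poly A = (\<Prod>e\<leftarrow>es. [:- e, 1:])" by simp
  thus ?thesis ..
qed

text \<open>Sorting the roots only permutes the linear factors. With the factors in this order, the
  diagonalization below puts the largest eigenvalue in position 0.\<close>

lemma char_poly_eigenvalues_desc:
  assumes "A \<in> carrier_mat n n" and "transpose_mat A = A"
  shows "char_poly A = (\<Prod>e\<leftarrow>eigenvalues_desc A. [:- e, 1:])"
proof -
  obtain es where es: "char_poly A = (\<Prod>e\<leftarrow>es. [:- e, 1:])"
    using symmetric_real_char_poly_splits[OF assms] by blast
  have "proots (\<Prod>e\<leftarrow>es. [:- e, 1:]) = mset es"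
    by (induction es) (auto simp: proots_mult prod_list_zero_iff image_iff simp del: mult_pCons_left)
  hence "mset (eigenvalues_desc A) = mset es"
    unfolding eigenvalues_desc_def es by simp
  hence "mset (map (\<lambda>e. [:- e, 1:]) (eigenvalues_desc A)) = mset (map (\<lambda>e. [:- e, 1:]) es)"
    by simp
  thus ?thesis unfolding es by (metis prod_mset_prod_list)
qed

lemma eigenvalues_desc_nth_mono:
  assumes "i \<le> j" "j < length (eigenvalues_desc A)"
  shows "eigenvalues_desc A ! j \<le> eigenvalues_desc A ! i"
  using assms unfolding eigenvalues_desc_def
  by (auto simp: rev_nth intro!: sorted_nth_mono)

section \<open>Orthogonal diagonalization of real symmetric matrices\<close>

text \<open>
  A Householder reflection; for \<open>v\<close> the first unit vector the denominator is 0, and the junk value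
  0 of the quotient turns the formula into the identity matrix.
\<close>
lemma symmetric_orthogonal_mat_first_col:
  fixes v :: "real vec"
  assumes v: "v \<in> carrier_vec n" and unit: "v \<bullet> v = 1" and n: "0 < n"
  shows "\<exists>H \<in> carrier_mat n n. transpose_mat H = H \<and> H * H = 1\<^sub>m n \<and> col H 0 = v"
proof -
  \<comment> \<open>With u = v - e_0 and s = |u|^2, \<open>H\<close> is I - (2 / s) u u^T, the
    reflection that exchanges \<open>v\<close> and e_0.\<close>
  define \<delta> :: "nat \<Rightarrow> nat \<Rightarrow> real" where "\<delta> i j = (if i = j then 1 else 0)" for i j
  define u where "u i = v $ i - \<delta> i 0" for i
  define s where "s = (\<Sum>i<n. u i * u i)"
  define t where "t = 2 / s"
  define H where "H = mat n n (\<lambda>(i, j). \<delta> i j - t * u i * u j)"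
  have sv: "(\<Sum>i<n. v $ i * v $ i) = 1"
    using unit v by (simp add: scalar_prod_def lessThan_atLeast0)
  \<comment> \<open>As \<open>v\<close> has length 1, |v - e_0|^2 = 2 - 2 v_0. For s \<noteq> 0 this
    gives t u_0 = -1, so the first column of \<open>H\<close> is e_0 + u = v.\<close>
  have "s = (\<Sum>i<n. v $ i * v $ i - (2 * v $ i - 1) * \<delta> i 0)"
    unfolding s_def by (rule sum.cong) (auto simp: u_def \<delta>_def algebra_simps)
  also have "\<dots> = 1 - (2 * v $ 0 - 1)"
    using n by (simp add: sum_subtractf sv \<delta>_def if_distrib[of "\<lambda>x. _ * x"] cong: if_cong)
  finally have s: "s = - 2 * u 0" by (simp add: u_def \<delta>_def)
  have u0: "u i = 0" if "s = 0" "i < n" for i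
  proof -
    have "(\<Sum>i<n. u i * u i) = 0" using that s_def by simp
    hence "u i * u i = 0" using that(2) by (subst (asm) sum_nonneg_eq_0_iff) auto
    thus ?thesis by simp
  qed
  \<comment> \<open>This also holds for s = 0, where \<open>t\<close> is 0. It makes the terms in
    u_i u_j cancel in \<open>H * H\<close>.\<close>
  have tts: "t * t * s = 2 * t" by (simp add: t_def)
  have H: "H \<in> carrier_mat n n" by (simp add: H_def)
  moreover have "transpose_mat H = H"
    by (rule eq_matI) (auto simp: H_def \<delta>_def)
  moreover have "H * H = 1\<^sub>m n"
  proof (rule eq_matI)
    fix i j assume "i < dim_row (1\<^sub>m n)" "j < dim_col (1\<^sub>m n)"
    hence ij: "i < n" "j < n" by auto
    have "(H * H) $$ (i, j) = (\<Sum>k<n. (\<delta> i k - t * u i * u k) * (\<delta> k j - t * u k * u j))"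
      using ij by (simp add: H_def scalar_prod_def lessThan_atLeast0)
    also have "\<dots> = (\<Sum>k<n. \<delta> i k * \<delta> k j - t * u j * (\<delta> i k * u k) - t * u i * (\<delta> k j * u k)
        + t * t * u i * u j * (u k * u k))"
      by (rule sum.cong) (auto simp: algebra_simps)
    also have "\<dots> = (\<Sum>k<n. \<delta> i k * \<delta> k j) - t * u j * (\<Sum>k<n. \<delta> i k * u k)
        - t * u i * (\<Sum>k<n. \<delta> k j * u k) + t * t * u i * u j * s"
      by (simp add: sum.distrib sum_subtractf sum_distrib_left s_def)
    also have "(\<Sum>k<n. \<delta> i k * \<delta> k j) = \<delta> i j"
      using ij by (simp add: \<delta>_def if_distrib[of "\<lambda>x. _ * x"] cong: if_cong)
    also have "(\<Sum>k<n. \<delta> i k * u k) = u i"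
      using ij by (simp add: \<delta>_def if_distribR sum.delta' if_distrib[of "\<lambda>x. x * _"] cong: if_cong)
    also have "(\<Sum>k<n. \<delta> k j * u k) = u j"
      using ij by (simp add: \<delta>_def if_distrib[of "\<lambda>x. x * _"] cong: if_cong)
    also have "\<delta> i j - t * u j * u i - t * u i * u j + t * t * u i * u j * s
        = \<delta> i j + u i * u j * (t * t * s - 2 * t)" by (simp add: algebra_simps)
    finally show "(H * H) $$ (i, j) = 1\<^sub>m n $$ (i, j)"
      using ij by (simp add: tts \<delta>_def)
  qed (use H in auto)
  moreover have "col H 0 = v"
  proof (rule eq_vecI)
    fix i assume "i < dim_vec v"
    hence i: "i < n" using v by auto
    have "- (t * u i * u 0) = u i"
      using s u0[OF _ i] by (cases "s = 0") (auto simp: t_def)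
    thus "col H 0 $ i = v $ i"
      using i n by (simp add: H_def u_def)
  qed (use v H in auto)
  ultimately show ?thesis by blast
qed

lemma mult_block_diag_mat:
  assumes "A \<in> carrier_mat k k" "B \<in> carrier_mat k k" "C \<in> carrier_mat m m" "D \<in> carrier_mat m m"
  shows "four_block_mat A (0\<^sub>m k m) (0\<^sub>m m k) C * four_block_mat B (0\<^sub>m k m) (0\<^sub>m m k) D
    = four_block_mat (A * B) (0\<^sub>m k m) (0\<^sub>m m k) (C * D)"
  using assms by (subst mult_four_block_mat[of _ k k _ m _ m]) auto

text \<open>Deflation: a reflection sends a unit eigenvector for \<open>e\<close> to the first basis
  vector and splits off a 1 x 1 block; the induction treats the rest. Since \<open>es\<close> is
  prescribed, the diagonal can later be taken in non-increasing order.\<close>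

lemma symmetric_mat_diagonalization:
  fixes A :: "real mat"
  assumes "A \<in> carrier_mat n n" and "transpose_mat A = A"
    and "char_poly A = (\<Prod>e\<leftarrow>es. [:- e, 1:])"
  shows "\<exists>P \<in> carrier_mat n n. P * transpose_mat P = 1\<^sub>m n \<and>
    A = P * mat_diag n (\<lambda>i. es ! i) * transpose_mat P"
  using assms
proof (induction es arbitrary: n A)
  case Nil
  hence "n = 0" using degree_monic_char_poly[of A n] by auto
  thus ?case using Nil(1) by (intro bexI[of _ "1\<^sub>m n"]) auto
next
  case (Cons e es)
  note A = Cons.prems(1) and sym = Cons.prems(2)
  \<comment> \<open>Comparing degrees shows that \<open>n\<close> is positive, so there is a first
    basis vector.\<close>
  have "degree (\<Prod>e\<leftarrow>es. [:- e, 1:]) + 1 = n"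
    using degree_monic_char_poly[OF A] Cons.prems(3)
    by (simp add: degree_mult_eq prod_list_zero_iff image_iff del: mult_pCons_left)
  then obtain m where n: "n = Suc m" by (cases n) auto
  have "eigenvalue A e"
    unfolding eigenvalue_root_char_poly[OF A] Cons.prems(3) by simp
  then obtain v0 where v0: "v0 \<in> carrier_vec n" "v0 \<noteq> 0\<^sub>v n" "A *\<^sub>v v0 = e \<cdot>\<^sub>v v0"
    using A unfolding eigenvalue_def eigenvector_def by auto
  define r where "r = v0 \<bullet> v0"
  have r: "r > 0"
    using v0 conjugate_square_greater_0_vec[of v0 n] by (simp add: r_def)
  define v where "v = (1 / sqrt r) \<cdot>\<^sub>v v0"
  have v: "v \<in> carrier_vec n" using v0 by (simp add: v_def)
  have vv: "v \<bullet> v = 1"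
    using v0(1) r by (simp add: v_def r_def[symmetric] divide_simps)
  have Av: "A *\<^sub>v v = e \<cdot>\<^sub>v v"
    using v0 A by (simp add: v_def mult_mat_vec smult_smult_assoc mult.commute)
  obtain H where H: "H \<in> carrier_mat n n" "transpose_mat H = H" "H * H = 1\<^sub>m n" "col H 0 = v"
    using symmetric_orthogonal_mat_first_col[OF v vv] n by auto
  define A' where "A' = H * A * H"
  have A': "A' \<in> carrier_mat n n" using A H by (simp add: A'_def)
  have symA': "transpose_mat A' = A'"
    using A H(1) by (simp add: A'_def transpose_mult[of _ n n _ n] H(2) sym)
  \<comment> \<open>\<open>H\<close> is its own inverse, so A' e_0 = H A v = e H v = e e_0. By
    symmetry the first row vanishes off the diagonal as well.\<close>
  have "col A' 0 = (H * A) *\<^sub>v v"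
    unfolding A'_def using H n A by (subst col_mult2[of _ n n _ n]) auto
  also have "\<dots> = e \<cdot>\<^sub>v (H *\<^sub>v col H 0)"
    using H(1) A v by (simp add: Av H(4) mult_mat_vec)
  also have "H *\<^sub>v col H 0 = col (1\<^sub>m n) 0"
    using H(1,3) n by (metis col_mult2 zero_less_Suc)
  finally have col0: "col A' 0 = e \<cdot>\<^sub>v unit_vec n 0" using n by simp
  have i0: "A' $$ (i, 0) = (if i = 0 then e else 0)" if "i < n" for i
    using arg_cong[OF col0, of "\<lambda>w. w $ i"] that A' n by (auto simp: unit_vec_def)
  have zi: "A' $$ (0, i) = (if i = 0 then e else 0)" if "i < n" for i
    using i0[OF that] arg_cong[OF symA', of "\<lambda>M. M $$ (0, i)"] that A' n by auto
  define E where "E = mat 1 1 (\<lambda>_. e)"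
  define D where "D = mat m m (\<lambda>(i, j). A' $$ (Suc i, Suc j))"
  have ED: "E \<in> carrier_mat 1 1" "D \<in> carrier_mat m m" by (auto simp: E_def D_def)
  have block: "A' = four_block_mat E (0\<^sub>m 1 m) (0\<^sub>m m 1) D"
    by (rule eq_matI) (use A' n i0 zi in \<open>auto simp: E_def D_def\<close>)
  have symD: "transpose_mat D = D"
  proof (rule eq_matI)
    fix i j assume "i < dim_row D" "j < dim_col D"
    thus "transpose_mat D $$ (i, j) = D $$ (i, j)"
      using arg_cong[OF symA', of "\<lambda>M. M $$ (Suc i, Suc j)"] A' n by (simp add: D_def)
  qed (auto simp: D_def)
  have "similar_mat A' A"
    by (rule similar_matI[of _ _ H H n]) (use A A' H in \<open>auto simp: A'_def\<close>)
  hence "char_poly A = char_poly A'" by (simp add: char_poly_similar)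
  also have "\<dots> = char_poly E * char_poly D"
    unfolding block by (rule char_poly_four_block_zeros_col) (use ED in auto)
  also have "char_poly E = [:- e, 1:]"
    by (simp add: E_def char_poly_defs det_def sign_def)
  finally have "[:- e, 1:] * char_poly D = [:- e, 1:] * (\<Prod>e\<leftarrow>es. [:- e, 1:])"
    using Cons.prems(3) by simp
  hence "char_poly D = (\<Prod>e\<leftarrow>es. [:- e, 1:])"
    by (metis mult_cancel_left pCons_eq_0_iff zero_neq_one)
  from Cons.IH[OF ED(2) symD this] obtain R where R: "R \<in> carrier_mat m m"
    "R * transpose_mat R = 1\<^sub>m m" "D = R * mat_diag m (\<lambda>i. es ! i) * transpose_mat R" by blast
  \<comment> \<open>The orthogonal matrix \<open>R\<close> for the block \<open>D\<close> is
    extended by one fixed coordinate; undoing the reflection makes \<open>H * S\<close> the matrix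
    for \<open>A\<close>.\<close>
  define S where "S = four_block_mat (1\<^sub>m 1) (0\<^sub>m 1 m) (0\<^sub>m m 1) R"
  let ?d = "mat_diag n (\<lambda>i. (e # es) ! i)" and ?d' = "mat_diag m (\<lambda>i. es ! i)"
  have S: "S \<in> carrier_mat n n" by (rule carrier_matI) (use R(1) n in \<open>auto simp: S_def\<close>)
  have ST: "transpose_mat S = four_block_mat (1\<^sub>m 1) (0\<^sub>m 1 m) (0\<^sub>m m 1) (transpose_mat R)"
    unfolding S_def using R(1) by (subst transpose_four_block_mat) auto
  have SST: "S * transpose_mat S = 1\<^sub>m n"
    unfolding ST unfolding S_def using R(1,2) n by (simp add: mult_block_diag_mat)
  have d: "?d = four_block_mat E (0\<^sub>m 1 m) (0\<^sub>m m 1) ?d'"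
    by (rule eq_matI) (use n in \<open>auto simp: mat_diag_def E_def nth_Cons'\<close>)
  have "S * ?d * transpose_mat S = A'"
    unfolding ST unfolding S_def d block using R(1,3) ED
    by (simp add: mult_block_diag_mat mult_carrier_mat[of _ m m])
  hence "H * (S * ?d * transpose_mat S) * H = H * (H * A * H) * H" by (simp add: A'_def)
  also have "\<dots> = (H * H) * A * (H * H)"
    using H(1) A by (simp add: assoc_mult_mat[of _ n n _ n _ n])
  also have "\<dots> = A" using A H(3) by simp
  finally have "A = (H * S) * ?d * (transpose_mat S * H)"
    using H(1) S by (simp add: assoc_mult_mat[of _ n n _ n _ n] mult_carrier_mat[of _ n n])
  moreover have HS: "transpose_mat S * H = transpose_mat (H * S)"
    using H(1,2) S by (simp add: transpose_mult[of _ n n _ n])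
  moreover have "(H * S) * transpose_mat (H * S) = 1\<^sub>m n"
  proof -
    have "(H * S) * (transpose_mat S * H) = H * (S * transpose_mat S) * H"
      using H(1) S by (simp add: assoc_mult_mat[of _ n n _ n _ n])
    also have "\<dots> = 1\<^sub>m n" using H(1,3) by (simp add: SST)
    finally show ?thesis by (simp add: HS)
  qed
  ultimately show ?case using H(1) S by (intro bexI[of _ "H * S"]) auto
qed

section \<open>The min-max bound for the second eigenvalue\<close>

text \<open>
  A plane meets the hyperplane spanned by the eigenvectors of all eigenvalues but the first.
\<close>
lemma rayleigh_on_plane_le:
  fixes A :: "real mat"
  assumes A: "A \<in> carrier_mat n n" and sym: "transpose_mat A = A"
    and cp: "char_poly A = (\<Prod>e\<leftarrow>es. [:- e, 1:])" and n: "0 < n"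
    and le: "\<And>i. 1 \<le> i \<Longrightarrow> i < n \<Longrightarrow> es ! i \<le> c"
    and x: "x \<in> carrier_vec n" and y: "y \<in> carrier_vec n"
  shows "\<exists>p q. (p \<noteq> 0 \<or> q \<noteq> 0) \<and>
    (let w = p \<cdot>\<^sub>v x + q \<cdot>\<^sub>v y in w \<bullet> (A *\<^sub>v w) \<le> c * (w \<bullet> w))"
proof -
  let ?d = "mat_diag n (\<lambda>i. es ! i)"
  obtain P where P: "P \<in> carrier_mat n n" "P * transpose_mat P = 1\<^sub>m n"
    "A = P * ?d * transpose_mat P"
    using symmetric_mat_diagonalization[OF A sym cp] by blast
  let ?T = "transpose_mat P"
  have T: "?T \<in> carrier_mat n n" using P(1) by simp
  define a b where "a = (?T *\<^sub>v x) $ 0" and "b = (?T *\<^sub>v y) $ 0"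
  \<comment> \<open>The coordinate of \<open>w\<close> along the first eigenvector is p a + q b. It
    vanishes for p = b, q = - a, and for every choice if a = b = 0.\<close>
  obtain p q where pq: "p \<noteq> 0 \<or> q \<noteq> 0" "p * a + q * b = 0"
  proof (cases "a = 0 \<and> b = 0")
    case True thus ?thesis using that[of 1 0] by simp
  next
    case False thus ?thesis using that[of b "- a"] by auto
  qed
  define w where "w = p \<cdot>\<^sub>v x + q \<cdot>\<^sub>v y"
  define z where "z = ?T *\<^sub>v w"
  have w: "w \<in> carrier_vec n" using x y by (simp add: w_def)
  have z: "z \<in> carrier_vec n" using T w by (simp add: z_def)
  have "z = p \<cdot>\<^sub>v (?T *\<^sub>v x) + q \<cdot>\<^sub>v (?T *\<^sub>v y)"
    unfolding z_def w_def using T x y by (simp add: mult_add_distrib_mat_vec mult_mat_vec)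
  hence z0: "z $ 0 = 0" using T x y n pq(2) by (simp add: a_def b_def)
  have dz: "?d *\<^sub>v z \<in> carrier_vec n" using mult_mat_vec_carrier[OF mat_diag_dim z] .
  \<comment> \<open>\<open>P\<close> is orthogonal, so passing to the eigencoordinates
    \<open>z\<close> preserves length and turns the form of \<open>A\<close> into a diagonal
    one.\<close>
  have "P *\<^sub>v z = w"
    unfolding z_def using assoc_mult_mat_vec[OF P(1) T w] P(2) w by simp
  hence "w \<bullet> w = z \<bullet> z"
    using transpose_vec_mult_scalar[OF P(1) z w] z_def by simp
  hence ww: "w \<bullet> w = (\<Sum>i<n. z $ i * z $ i)"
    using z by (simp add: scalar_prod_def lessThan_atLeast0)
  have "A *\<^sub>v w = P *\<^sub>v (?d *\<^sub>v z)"
    unfolding P(3) z_def using P(1) T w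
    by (simp add: assoc_mult_mat_vec[of _ n n _ n] mult_carrier_mat[of _ n n])
  hence "w \<bullet> (A *\<^sub>v w) = z \<bullet> (?d *\<^sub>v z)"
    using transpose_vec_mult_scalar[OF P(1) dz w] z_def by simp
  also have "\<dots> = (\<Sum>i<n. z $ i * (es ! i * z $ i))"
    using z by (auto simp: scalar_prod_def lessThan_atLeast0 mat_diag_def
        if_distrib[of "\<lambda>x. x * _"] sum.delta cong: if_cong intro!: sum.cong)
  \<comment> \<open>Only \<open>es ! 0\<close> may exceed \<open>c\<close>, and its coordinate is
    zero; the other terms compare one by one because squares are nonnegative.\<close>
  also have "\<dots> \<le> (\<Sum>i<n. c * (z $ i * z $ i))"
  proof (rule sum_mono)
    fix i assume i: "i \<in> {..<n}"
    show "z $ i * (es ! i * z $ i) \<le> c * (z $ i * z $ i)"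
    proof (cases "i = 0")
      case False
      hence "es ! i * (z $ i * z $ i) \<le> c * (z $ i * z $ i)"
        using le i by (intro mult_right_mono) auto
      thus ?thesis by (simp add: mult_ac)
    qed (simp add: z0)
  qed
  also have "\<dots> = c * (w \<bullet> w)" by (simp add: ww sum_distrib_left)
  finally have "w \<bullet> (A *\<^sub>v w) \<le> c * (w \<bullet> w)" .
  with pq(1) show ?thesis by (auto simp: Let_def w_def)
qed

section \<open>Walks and graph distance\<close>

text \<open>A walk becomes a path by repeatedly cutting out closed subwalks, and no cut increases
  the length.\<close>

lemma (in wf_digraph) length_awalk_to_apath_le:
  assumes "awalk u p v"
  shows "length (awalk_to_apath p) \<le> length p"
  using assms
proof (induct rule: awalk_to_apath_induct)
  case (path p)
  thus ?case by (auto simp: awalk_to_apath.simps)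
next
  case (decomp p q r s)
  hence "is_awalk_cyc_decomp p (q, r, s)"
    using awalk_cyc_decomp_has_prop[OF decomp(1)] by auto
  hence "length (q @ s) \<le> length p" by auto
  thus ?case using decomp step_awalk_to_apath[of _ p _ q r s] by simp
qed

lemma length_rev_path [simp]: "length (rev_path p) = length p"
  by (induction p) auto

context pair_wf_digraph
begin

text \<open>\<open>graph_dist\<close> minimises over paths only; cutting out closed subwalks extends
  the bound to all walks.\<close>

lemma graph_dist_le_length:
  assumes "awalk u p v"
  shows "graph_dist G u v \<le> length p"
proof -
  have "graph_dist G u v \<le> length (awalk_to_apath p)"
    unfolding graph_dist_def using apath_awalk_to_apath[OF assms] by (intro Least_le) auto
  thus ?thesis using length_awalk_to_apath_le[OF assms] by simp
qed

text \<open>The given walk makes the set under \<open>LEAST\<close> nonempty; on an empty set its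
  value would be unspecified.\<close>

lemma graph_dist_attained:
  assumes "awalk u p v"
  obtains q where "awalk u q v" "length q = graph_dist G u v"
proof -
  have "\<exists>k q. apath u q v \<and> length q = k"
    using apath_awalk_to_apath[OF assms] by blast
  from LeastI_ex[OF this] show ?thesis
    using that unfolding graph_dist_def by (blast intro: awalkI_apath)
qed

lemma graph_dist_eq_0_imp:
  assumes "awalk u p v" "graph_dist G u v = 0"
  shows "u = v"
  using graph_dist_attained[OF assms(1)] assms(2) by (auto intro: awalk_empty_ends)

lemma graph_dist_eq_1_imp:
  assumes "awalk u p v" "graph_dist G u v = 1"
  shows "(u, v) \<in> parcs G"
proof -
  obtain q where "awalk u q v" "length q = 1"
    using graph_dist_attained[OF assms(1)] assms(2) by auto
  thus ?thesis by (auto simp: length_Suc_conv awalk_simps)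
qed

lemma graph_dist_self:
  assumes "u \<in> pverts G"
  shows "graph_dist G u u = 0"
  using graph_dist_le_length[of u "[]" u] assms by (simp add: awalk_Nil_iff)

lemma graph_dist_arc_le:
  assumes "(u, v) \<in> parcs G"
  shows "graph_dist G u v \<le> 1"
  using graph_dist_le_length[OF arc_implies_awalk[of "(u, v)"]] assms by simp

text \<open>The first i arcs end at the tail of arc i, so arcs i to j - 1 form a walk. Its length j
  - i bounds distances along a cycle.\<close>

lemma awalk_tail_nth:
  assumes "awalk u p w" "i \<le> j" "j < length p"
  shows "awalk (fst (p ! i)) (take (j - i) (drop i p)) (fst (p ! j))"
proof -
  have last: "awlast u (take k p) = fst (p ! k)" if "k < length p" for k
  proof -
    have "awalk u (take k p @ p ! k # drop (Suc k) p) w"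
      using assms(1) id_take_nth_drop[OF that, symmetric] by simp
    thus ?thesis by (simp add: awalk_Cons_iff)
  qed
  let ?m = "take (j - i) (drop i p)"
  have tj: "take j p = take i p @ ?m"
    using take_add[of i "j - i" p] assms(2) by simp
  have "awalk u (take j p @ drop j p) w" using assms(1) by simp
  hence "awalk u (take j p) (awlast u (take j p))" by (simp del: append_take_drop_id)
  hence "awalk (awlast u (take i p)) ?m (awlast u (take j p))"
    unfolding tj by auto
  thus ?thesis using last assms(2,3) by simp
qed

end

lemma (in pair_sym_digraph) graph_dist_commute: "graph_dist G u v = graph_dist G v u"
proof -
  have "(\<exists>p. apath u p v \<and> length p = k) \<longleftrightarrow> (\<exists>p. apath v p u \<and> length p = k)" for k
    using apath_rev_path length_rev_path by blast
  thus ?thesis unfolding graph_dist_def by simp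
qed

section \<open>Four points on a chordless cycle\<close>

text \<open>\<open>cycle\<close> makes the heads of the arcs distinct. On a closed walk the tails
  are a rotation of the heads, so they are distinct too, and each head is the next tail modulo the
  length.\<close>

lemma (in pair_wf_digraph) cycle_arcs_conv:
  assumes "cycle p"
  shows "distinct (map fst p)"
    and "\<And>i. i < length p \<Longrightarrow> p ! i = (fst (p ! i), fst (p ! (Suc i mod length p)))"
    and "\<exists>u. awalk u p u"
proof -
  obtain u where u: "awalk u p u" "distinct (tl (awalk_verts u p))" "p \<noteq> []"
    using assms unfolding cycle_def by blast
  show "\<exists>u. awalk u p u" using u by blast
  have cas: "cas u p u" using u(1) by auto
  have eq: "map fst p @ [snd (last p)] = fst (hd p) # map snd p"
    using awalk_verts_conv[of u p] awalk_verts_conv'[OF cas] u(3) by simp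
  have "awalk_verts u p = fst (hd p) # map snd p"
    using awalk_verts_conv'[OF cas] u(3) by simp
  hence d: "distinct (map snd p)" using u(2) by simp
  have closed: "snd (last p) = fst (hd p)"
    using awlast_if_cas[OF cas] awhd_if_cas[OF cas] u(3)
    by (simp add: awalk_verts_conv hd_append hd_map)
  \<comment> \<open>Closedness makes the extra vertex on the two sides of \<open>eq\<close> the
    same, so it cancels from the multisets.\<close>
  have "mset (map fst p) = mset (map snd p)"
    using arg_cong[OF eq, of mset] closed by simp
  thus "distinct (map fst p)" using d mset_eq_imp_distinct_iff by blast
  fix i assume i: "i < length p"
  have "snd (p ! i) = (map fst p @ [snd (last p)]) ! Suc i"
    unfolding eq using i by simp
  also have "\<dots> = fst (p ! (Suc i mod length p))"
  proof (cases "Suc i < length p")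
    case False
    hence "Suc i = length p" using i by simp
    thus ?thesis using closed u(3) by (simp add: nth_append hd_conv_nth)
  qed (simp add: nth_append)
  finally show "p ! i = (fst (p ! i), fst (p ! (Suc i mod length p)))"
    by (simp add: prod_eq_iff)
qed

text \<open>In a shortest non-geodesic stretch of k arcs, \<open>a\<close>, \<open>b\<close> are the
  first two vertices, \<open>c\<close>, \<open>d\<close> the last two, and m = k - 1. Then d(b,c) =
  k - 2 and d(a,d) \<le> k - 1, with sum at most 2 k - 3 = 2 m - 1.\<close>

lemma (in pair_graph) not_chordal_four_points:
  assumes "\<not> chordal G"
  obtains a b c d and m :: nat where "distinct [a, b, c, d]" "{a, b, c, d} \<subseteq> pverts G"
    "graph_dist G a b = 1" "graph_dist G c d = 1"
    "graph_dist G a c = m" "graph_dist G b d = m"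
    "graph_dist G b c + graph_dist G a d + 1 \<le> 2 * m"
proof -
  obtain p where p: "cycle p" "4 \<le> length p" and no_chord: "\<And>x y. \<not> is_chord G p x y"
    using assms unfolding chordal_def by blast
  define l v where "l = length p" and "v i = fst (p ! i)" for i
  note arcs = cycle_arcs_conv[OF p(1)]
  obtain u where u: "awalk u p u" using arcs(3) by blast
  have l: "4 \<le> l" using p(2) by (simp add: l_def)
  have v_eq: "v i = v j \<longleftrightarrow> i = j" if "i < l" "j < l" for i j
    using nth_eq_iff_index_eq[OF arcs(1), of i j] that by (simp add: l_def v_def)
  have nth: "p ! i = (v i, v (Suc i mod l))" if "i < l" for i
    using arcs(2)[of i] that by (simp add: l_def v_def)
  have arc: "(v i, v (Suc i mod l)) \<in> parcs G" if "i < l" for i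
  proof -
    have "p ! i \<in> parcs G"
      using u nth_mem[of i p] that unfolding awalk_def by (auto simp: l_def)
    thus ?thesis using nth[OF that] by simp
  qed
  have vert: "v i \<in> pverts G" if "i < l" for i
    using arc[OF that] by (rule in_arcsD1)
  have walk: "awalk (v i) (take (j - i) (drop i p)) (v j)" if "i \<le> j" "j < l" for i j
    using awalk_tail_nth[OF u that(1)] that(2) by (simp add: l_def v_def)
  have dist_le: "graph_dist G (v i) (v j) \<le> j - i" if "i \<le> j" "j < l" for i j
    using graph_dist_le_length[OF walk[OF that]] by simp
  \<comment> \<open>Stretches do not wrap past the last index. The closing arc joins the ends of the
    stretch of l - 1 \<ge> 3 arcs, so that one is bad and a least bad length exists.\<close>
  define bad where "bad k \<longleftrightarrow> (\<exists>i. i + k < l \<and> graph_dist G (v i) (v (i + k)) < k)" for k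
  have "graph_dist G (v (l - 1)) (v 0) \<le> 1"
    using graph_dist_arc_le[OF arc[of "l - 1"]] l by simp
  hence "bad (l - 1)"
    unfolding bad_def using l graph_dist_commute[of "v (l - 1)" "v 0"] by (intro exI[of _ 0]) auto
  define k where "k = (LEAST k. bad k)"
  have "bad k" unfolding k_def using \<open>bad (l - 1)\<close> by (rule LeastI)
  then obtain i where i: "i + k < l" "graph_dist G (v i) (v (i + k)) < k"
    unfolding bad_def by blast
  have geodesic: "graph_dist G (v i') (v j) = j - i'" if "i' \<le> j" "j < l" "j - i' < k" for i' j
  proof -
    have "\<not> bad (j - i')" using that(3) unfolding k_def by (rule not_less_Least)
    moreover have "i' + (j - i') = j" using that(1) by simp
    ultimately have "\<not> graph_dist G (v i') (v j) < j - i'"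
      using that(2) unfolding bad_def by metis
    thus ?thesis using dist_le[OF that(1,2)] by simp
  qed
  have w: "awalk (v i) (take (i + k - i) (drop i p)) (v (i + k))"
    using walk[of i "i + k"] i(1) by simp
  have "k \<noteq> 0" using i(2) by auto
  have d0: "graph_dist G (v i) (v (i + k)) \<noteq> 0"
    using graph_dist_eq_0_imp[OF w] v_eq[of i "i + k"] i(1) \<open>k \<noteq> 0\<close> by auto
  \<comment> \<open>For k = 2 the ends are adjacent. Not being a chord, their edge lies on the
    cycle, which for vertices two steps apart would force l = 3.\<close>
  have "k \<noteq> 2"
  proof
    assume k: "k = 2"
    hence "graph_dist G (v i) (v (i + k)) = 1" using d0 i(2) by auto
    hence a: "(v i, v (i + 2)) \<in> parcs G" using graph_dist_eq_1_imp[OF w] k by simp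
    have "v j \<in> fst ` set p" if "j < l" for j
      using that by (auto simp: v_def l_def)
    hence "(v i, v (i + 2)) \<in> set p \<or> (v (i + 2), v i) \<in> set p"
      using no_chord[of "v i" "v (i + 2)"] a i(1) k unfolding is_chord_def by auto
    then obtain j where j: "j < l" "p ! j = (v i, v (i + 2)) \<or> p ! j = (v (i + 2), v i)"
      by (metis in_set_conv_nth l_def)
    have "Suc j mod l < l" using l by simp
    moreover have "v j = v i \<and> v (Suc j mod l) = v (i + 2) \<or>
        v j = v (i + 2) \<and> v (Suc j mod l) = v i"
      using j(2) unfolding nth[OF j(1)] by blast
    ultimately have "j = i \<and> Suc j mod l = i + 2 \<or> j = i + 2 \<and> Suc j mod l = i"
      using v_eq[OF j(1)] v_eq[of "Suc j mod l"] i(1) k by simp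
    thus False using i(1) k l by (cases "Suc j = l") auto
  qed
  \<comment> \<open>k = 1 would force distance 0 between distinct vertices. From k \<ge> 3 on, the
    two end edges of the stretch are disjoint.\<close>
  with i(2) d0 have k: "3 \<le> k" by linarith
  show ?thesis
  proof (rule that[of "v i" "v (i + 1)" "v (i + k - 1)" "v (i + k)" "k - 1"])
    show "distinct [v i, v (i + 1), v (i + k - 1), v (i + k)]"
      using i(1) k by (auto simp: v_eq)
    show "{v i, v (i + 1), v (i + k - 1), v (i + k)} \<subseteq> pverts G"
      using i(1) k by (auto intro!: vert)
    show "graph_dist G (v i) (v (i + 1)) = 1"
      using geodesic[of i "i + 1"] i(1) k by simp
    show "graph_dist G (v (i + k - 1)) (v (i + k)) = 1"
      using geodesic[of "i + k - 1" "i + k"] i(1) k by simp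
    show "graph_dist G (v i) (v (i + k - 1)) = k - 1"
      using geodesic[of i "i + k - 1"] i(1) k by simp
    show "graph_dist G (v (i + 1)) (v (i + k)) = k - 1"
      using geodesic[of "i + 1" "i + k"] i(1) k by simp
    have "graph_dist G (v (i + 1)) (v (i + k - 1)) = k - 2"
      using geodesic[of "i + 1" "i + k - 1"] i(1) k by simp
    thus "graph_dist G (v (i + 1)) (v (i + k - 1)) + graph_dist G (v i) (v (i + k)) + 1
        \<le> 2 * (k - 1)"
      using i(2) k by linarith
  qed
qed

section \<open>Four points force a large second eigenvalue\<close>

text \<open>
  The quadratic form of \<open>A\<close> on \<open>p (e\<^sub>a + e\<^sub>c) + q (e\<^sub>b + e\<^sub>d)\<close> is
  \<open>2 m (p\<^sup>2 + q\<^sup>2) + 2 p q (2 + A\<^sub>b\<^sub>c + A\<^sub>a\<^sub>d)\<close>, which is at least \<open>- (p\<^sup>2 + q\<^sup>2)\<close>.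
\<close>
lemma second_eigenvalue_ge_minus_half:
  fixes A :: "real mat"
  assumes A: "A \<in> carrier_mat n n" and sym: "transpose_mat A = A"
    and idx: "a < n" "b < n" "c < n" "d < n" and dist: "distinct [a, b, c, d]"
    and diag: "\<And>i. i < n \<Longrightarrow> A $$ (i, i) = 0"
    and ab: "A $$ (a, b) = 1" and cd: "A $$ (c, d) = 1"
    and ac: "A $$ (a, c) = m" and bd: "A $$ (b, d) = m"
    and nonneg: "0 \<le> A $$ (b, c)" "0 \<le> A $$ (a, d)"
    and le: "A $$ (b, c) + A $$ (a, d) + 1 \<le> 2 * m"
  shows "- 1 / 2 \<le> eigenvalues_desc A ! 1"
proof (rule ccontr)
  let ?es = "eigenvalues_desc A" and ?s = "A $$ (b, c) + A $$ (a, d)"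
  define c' where "c' = ?es ! 1"
  assume "\<not> ?thesis"
  hence c': "c' < - 1 / 2" by (simp add: c'_def)
  have cp: "char_poly A = (\<Prod>e\<leftarrow>?es. [:- e, 1:])"
    by (rule char_poly_eigenvalues_desc[OF A sym])
  \<comment> \<open>With exactly \<open>n\<close> entries in the list, sortedness bounds every
    eigenvalue at an index from 1 to n - 1 by \<open>c'\<close>.\<close>
  have len: "length ?es = n"
    using degree_monic_char_poly[OF A] unfolding cp by (simp add: degree_linear_factors)
  have "?es ! i \<le> c'" if "1 \<le> i" "i < n" for i
    unfolding c'_def using that len by (intro eigenvalues_desc_nth_mono) auto
  from rayleigh_on_plane_le[OF A sym cp _ this, of "unit_vec n a + unit_vec n c"
      "unit_vec n b + unit_vec n d"] idx
  obtain p q where pq: "p \<noteq> 0 \<or> q \<noteq> 0" and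
    *: "(let w = p \<cdot>\<^sub>v (unit_vec n a + unit_vec n c) + q \<cdot>\<^sub>v (unit_vec n b + unit_vec n d)
       in w \<bullet> (A *\<^sub>v w) \<le> c' * (w \<bullet> w))"
    by auto
  define w where "w = p \<cdot>\<^sub>v (unit_vec n a + unit_vec n c) + q \<cdot>\<^sub>v (unit_vec n b + unit_vec n d)"
  have w: "w \<in> carrier_vec n" by (simp add: w_def)
  have w_prod: "w \<bullet> f = p * (f $ a + f $ c) + q * (f $ b + f $ d)" if "f \<in> carrier_vec n" for f
    using that idx unfolding w_def by (simp add: add_scalar_prod_distrib[of _ n])
  have Aw: "row A i \<bullet> w = p * (A $$ (i, a) + A $$ (i, c)) + q * (A $$ (i, b) + A $$ (i, d))"
    if "i < n" for i
    using w_prod[of "row A i"] that A w idx comm_scalar_prod[OF w, of "row A i"] by simp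
  have symA: "A $$ (j, i) = A $$ (i, j)" if "i < n" "j < n" for i j
    using arg_cong[OF sym, of "\<lambda>M. M $$ (i, j)"] A that by simp
  note entries = ab cd ac bd diag symA[of a b] symA[of c d] symA[of a c] symA[of b d]
    symA[of b c] symA[of a d]
  have "w \<bullet> (A *\<^sub>v w) \<le> c' * (w \<bullet> w)" using * by (simp add: Let_def w_def)
  moreover have "w \<bullet> w = 2 * (p\<^sup>2 + q\<^sup>2)"
    using w_prod[OF w] idx dist by (simp add: w_def power2_eq_square algebra_simps)
  moreover have "w \<bullet> (A *\<^sub>v w) = 2 * m * (p\<^sup>2 + q\<^sup>2) + 2 * (p * q) * (2 + ?s)"
    using w_prod[of "A *\<^sub>v w"] A w idx
    by (simp add: Aw entries power2_eq_square algebra_simps)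
  ultimately have form: "2 * m * (p\<^sup>2 + q\<^sup>2) + 2 * (p * q) * (2 + ?s) \<le> 2 * c' * (p\<^sup>2 + q\<^sup>2)"
    by (simp add: algebra_simps)
  have pos: "0 < p\<^sup>2 + q\<^sup>2" using pq by (simp add: sum_power2_gt_zero_iff)
  \<comment> \<open>This is (p + q)^2 \<ge> 0. As 0 \<le> 2 + ?s \<le> 2 m + 1, the cross term is at
    least - (2 m + 1) (p^2 + q^2), so the diagonal part 2 m (p^2 + q^2) leaves a deficit of at most
    p^2 + q^2.\<close>
  have "- (2 * (p * q)) \<le> p\<^sup>2 + q\<^sup>2"
    using zero_le_power2[of "p + q"] by (simp add: power2_sum)
  hence "- (2 * (p * q)) * (2 + ?s) \<le> (p\<^sup>2 + q\<^sup>2) * (2 + ?s)"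
    using nonneg by (intro mult_right_mono) auto
  also have "\<dots> \<le> (p\<^sup>2 + q\<^sup>2) * (2 * m + 1)"
    using le pos by (intro mult_left_mono) auto
  finally have "- (p\<^sup>2 + q\<^sup>2) \<le> 2 * m * (p\<^sup>2 + q\<^sup>2) + 2 * (p * q) * (2 + ?s)"
    by (simp add: algebra_simps)
  with form have "(- 1) * (p\<^sup>2 + q\<^sup>2) \<le> (2 * c') * (p\<^sup>2 + q\<^sup>2)" by simp
  hence "- 1 \<le> 2 * c'" using pos by (simp only: mult_le_cancel_right_pos)
  thus False using c' by simp
qed

theorem theorem3p1:
  fixes G :: "'a pair_pre_digraph" and vs :: "'a list"
  assumes "pair_graph G"
    and "Digraph_Component.connected (with_proj G)"
    and "card (pverts G) \<ge> 2"
    and "distinct vs" and "set vs = pverts G"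
    and "second_distance_eigenvalue G vs < - 1 / 2"
  shows "chordal G"
proof (rule ccontr)
  assume nc: "\<not> chordal G"
  interpret pair_graph G by (rule assms(1))
  obtain a b c d m where abcd: "distinct [a, b, c, d]" "{a, b, c, d} \<subseteq> pverts G"
    and dists: "graph_dist G a b = 1" "graph_dist G c d = 1" "graph_dist G a c = m"
      "graph_dist G b d = m" "graph_dist G b c + graph_dist G a d + 1 \<le> 2 * m"
    using not_chordal_four_points[OF nc] by metis
  let ?n = "length vs" and ?D = "distance_matrix G vs"
  have entry: "?D $$ (i, j) = real (graph_dist G (vs ! i) (vs ! j))" if "i < ?n" "j < ?n" for i j
    using that by (simp add: distance_matrix_def)
  \<comment> \<open>\<open>vs\<close> lists all vertices, so the four points have positions in the
    matrix, and distinct points have distinct positions.\<close>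
  obtain i j k l where ijkl: "i < ?n" "j < ?n" "k < ?n" "l < ?n"
    "vs ! i = a" "vs ! j = b" "vs ! k = c" "vs ! l = d"
    using abcd(2) assms(5) by (metis in_set_conv_nth insert_subset)
  have "- 1 / 2 \<le> eigenvalues_desc ?D ! 1"
  proof (rule second_eigenvalue_ge_minus_half[of _ ?n i j k l "real m"])
    show "transpose_mat ?D = ?D"
      by (rule eq_matI) (auto simp: distance_matrix_def graph_dist_commute)
    show "?D $$ (x, x) = 0" if "x < ?n" for x
      using that graph_dist_self[of "vs ! x"] assms(5) nth_mem[OF that] by (simp add: entry)
    show "?D $$ (j, k) + ?D $$ (i, l) + 1 \<le> 2 * real m"
      using dists(5) ijkl by (simp add: entry)
  qed (use ijkl abcd dists in \<open>auto simp: entry distance_matrix_def\<close>)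
  thus False using assms(6) by (simp add: second_distance_eigenvalue_def)
qed

end
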